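(* There is a function $g:\mathbb{Z}_{\ge 0}\to\mathbb{R}$ with $g(\lambda)=o(\lambda)$ as $\lambda\to\infty$ such that for all integers $n\ge 1$ and $\lambda\ge 0$, $$ f(n,1,\lambda) \le \max\left\{ n+2,\; 8\min\left\{\lambda, \frac{n-\lambda}{3}\right\} + g(\lambda) \right\}. $$
   Context: Let $[n]=\{1,\dots,n\}$. For non-negative integers $k,\lambda$, a family (set of distinct subsets) $\mathcal{F}\subset 2^{[n]}$ is called $k$-almost $\lambda$-Fisher if for every $F\in\mathcal{F}$ there are at most $k$ other sets $F'\in\mathcal{F}\setminus\{F\}$ with $|F\cap F'|\neq\lambda$. Define $f(n,k,\lambda)=\max\{|\mathcal{F}| : \mathcal{F}\subset 2^{[n]} \text{ is a } k\text{-almost } \lambda\text{-Fisher family}\}$. *)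

theory Defs
  imports Complex_Main "HOL-Library.Landau_Symbols"
begin

definition almost_Fisher :: "nat \<Rightarrow> nat \<Rightarrow> nat \<Rightarrow> nat set set \<Rightarrow> bool" where
  "almost_Fisher n k l \<F> \<longleftrightarrow>
     \<F> \<subseteq> Pow {1..n} \<and>
     (\<forall>F\<in>\<F>. card {F' \<in> \<F> - {F}. card (F \<inter> F') \<noteq> l} \<le> k)"

definition max_almost_Fisher :: "nat \<Rightarrow> nat \<Rightarrow> nat \<Rightarrow> nat" where
  "max_almost_Fisher n k l = Max {card \<F> |\<F>. almost_Fisher n k l \<F>}"

text \<open>The maximum is taken over a finite nonempty set, so it is attained.\<close>

lemma finite_almost_Fisher_cards: "finite {card \<F> |\<F>. almost_Fisher n k l \<F>}"
proof -
  have "{\<F>. almost_Fisher n k l \<F>} \<subseteq> Pow (Pow {1..n})"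
    by (auto simp: almost_Fisher_def)
  then have "finite {\<F>. almost_Fisher n k l \<F>}"
    by (rule finite_subset) simp
  then show ?thesis
    by simp
qed

lemma almost_Fisher_cards_nonempty: "{card \<F> |\<F>. almost_Fisher n k l \<F>} \<noteq> {}"
proof -
  have "almost_Fisher n k l {}"
    by (simp add: almost_Fisher_def)
  then show ?thesis
    by blast
qed

end

theory Submission
  imports Defs "HOL-Analysis.Convex" "HOL-Library.Indicator_Function" "HOL-Real_Asymp.Real_Asymp"
begin

text \<open>
  Let \<open>\<F>\<close> be a 1-almost \<open>l\<close>-Fisher family on \<open>{1..n}\<close> with at least \<open>n + 3\<close> members.
  Say that two members conflict if they do not meet in exactly \<open>l\<close> points; each member is in
  conflict with at most one other. The claimed bound holds with \<open>g l = 24 * sqrt l\<close>.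

  Since there are more than \<open>n + 2\<close> members, their indicator functions satisfy a linear relation
  whose coefficients sum to zero and vanish at a prescribed member. Taking inner products with
  the members shows that the Gram matrix minus \<open>l\<close> times the all-ones matrix, which is block
  diagonal with a block for each conflicting pair and each unpaired member, has a singular
  block. Used twice, this gives two singular blocks (\<open>degenerate_member_exists\<close>). Neither can be
  a single set of size \<open>l\<close>, so they are conflicting pairs. The kernel of such a block for a pair
  \<open>A\<close>, \<open>B\<close> provides a convex combination of the indicators of \<open>A\<close> and \<open>B\<close> that has squared norm
  \<open>l\<close> and inner product \<open>l\<close> with every member. Such a vector is unique, and two distinct pairs
  can only produce the same vector if it is the midpoint; hence \<open>A\<close> and \<open>B\<close> have equal size and
  \<open>card A + card (A \<inter> B) = 2 * l\<close> (\<open>balanced_pair_exists\<close>).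

  Now let \<open>h = l - card (A \<inter> B)\<close>, let \<open>S\<close> be the symmetric difference of \<open>A\<close> and \<open>B\<close>, a set of
  \<open>4 * h\<close> points, and choose a conflict-free subfamily \<open>\<R>\<close> containing at least half of the
  members. Subtracting the midpoint \<open>v\<close> from the indicators of the members of \<open>\<R>\<close> gives
  pairwise orthogonal vectors. Their entries are \<open>1/2\<close> or \<open>-1/2\<close> on \<open>S\<close>; at a point off \<open>S\<close> the
  entries are 0 or 1, or else 0 or \<open>-1\<close>, with the same sign for all members. So on \<open>S\<close> alone the
  inner products of distinct vectors are nonpositive, and comparing the squares of the two Gram
  matrices there (indexed by members, and by points) yields \<open>card \<R> \<le> 8 * h\<close>. Normalise the
  vectors and sum the squares of all their entries, which gives \<open>card \<R>\<close>. By Bessel's inequality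
  each point contributes at most 1, so \<open>S\<close> contributes at most \<open>4 * h\<close>; Parseval's identity for a
  weighted sum of the vectors and the Cauchy-Schwarz inequality bound the rest by
  \<open>sqrt (n * card \<R> / h)\<close> (\<open>Fisher_family_balanced_pair_bounds\<close>). As \<open>n < 2 * card \<R> \<le> 16 * h\<close>,
  this is at most \<open>12 * sqrt h\<close>. Finally \<open>h \<le> l\<close>, and \<open>3 * h \<le> n - l\<close> because \<open>A \<union> B\<close> has
  \<open>l + 3 * h\<close> points.
\<close>

section \<open>Linear relations and orthogonal families of real-valued functions\<close>

lemma nontrivial_relation_exists:
  fixes w :: "'i \<Rightarrow> 'j \<Rightarrow> real"
  assumes "finite J" "finite I" "card I > card J"
  shows "\<exists>z. (\<exists>i\<in>I. z i \<noteq> 0) \<and> (\<forall>j\<in>J. (\<Sum>i\<in>I. z i * w i j) = 0)"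
  using assms
proof (induction J arbitrary: I w rule: finite_induct)
  case empty
  then have "I \<noteq> {}" by auto
  then show ?case by (intro exI[of _ "\<lambda>_. 1"]) auto
next
  case (insert j J)
  show ?case
  proof (cases "\<forall>i\<in>I. w i j = 0")
    case True
    obtain z where "\<exists>i\<in>I. z i \<noteq> 0" "\<forall>k\<in>J. (\<Sum>i\<in>I. z i * w i k) = 0"
      using insert.IH[of I w] insert.prems insert.hyps by auto
    then show ?thesis using True by (intro exI[of _ z]) auto
  next
    case False
    then obtain p where p: "p \<in> I" "w p j \<noteq> 0" by blast
    define w' where "w' i k = w i k - w i j / w p j * w p k" for i k
    have "card (I - {p}) > card J"
      using insert.prems insert.hyps p by simp
    then obtain z where z: "\<exists>i\<in>I - {p}. z i \<noteq> 0"
      and z0: "\<forall>k\<in>J. (\<Sum>i\<in>I - {p}. z i * w' i k) = 0"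
      using insert.IH[of "I - {p}" w'] insert.prems by auto
    define c where "c = (\<Sum>i\<in>I - {p}. z i * w i j) / w p j"
    define z' where "z' = z(p := - c)"
    have split_p: "(\<Sum>i\<in>I. z' i * w i k) = (\<Sum>i\<in>I - {p}. z i * w i k) - c * w p k" for k
    proof -
      have "(\<Sum>i\<in>I. z' i * w i k) = z' p * w p k + (\<Sum>i\<in>I - {p}. z' i * w i k)"
        using insert.prems p by (simp add: sum.remove)
      also have "(\<Sum>i\<in>I - {p}. z' i * w i k) = (\<Sum>i\<in>I - {p}. z i * w i k)"
        by (rule sum.cong) (auto simp: z'_def)
      finally show ?thesis by (simp add: z'_def)
    qed
    have "(\<Sum>i\<in>I. z' i * w i k) = 0" if "k \<in> insert j J" for k
    proof (cases "k = j")
      case True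
      then show ?thesis using p by (simp add: split_p c_def)
    next
      case False
      then have "0 = (\<Sum>i\<in>I - {p}. z i * w' i k)" using z0 that by simp
      also have "\<dots> = (\<Sum>i\<in>I - {p}. z i * w i k) - c * w p k"
        by (simp add: w'_def c_def algebra_simps sum_subtractf sum_distrib_left
            sum_distrib_right sum_divide_distrib)
      finally show ?thesis by (simp add: split_p)
    qed
    moreover have "\<exists>i\<in>I. z' i \<noteq> 0" using z by (auto simp: z'_def)
    ultimately show ?thesis by blast
  qed
qed

lemma sum_square_orthogonal:
  fixes u :: "'i \<Rightarrow> 'e \<Rightarrow> real"
  assumes "finite R"
    and orth: "\<And>i j. i \<in> R \<Longrightarrow> j \<in> R \<Longrightarrow> i \<noteq> j \<Longrightarrow> (\<Sum>e\<in>E. u i e * u j e) = 0"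
  shows "(\<Sum>e\<in>E. (\<Sum>i\<in>R. a i * u i e)\<^sup>2) = (\<Sum>i\<in>R. (a i)\<^sup>2 * (\<Sum>e\<in>E. (u i e)\<^sup>2))"
proof -
  have "(\<Sum>e\<in>E. (\<Sum>i\<in>R. a i * u i e)\<^sup>2)
      = (\<Sum>e\<in>E. \<Sum>i\<in>R. \<Sum>j\<in>R. a i * a j * (u i e * u j e))"
    by (simp add: power2_eq_square sum_product algebra_simps)
  also have "\<dots> = (\<Sum>i\<in>R. \<Sum>j\<in>R. a i * a j * (\<Sum>e\<in>E. u i e * u j e))"
    by (subst sum.swap, intro sum.cong refl, subst sum.swap) (simp add: sum_distrib_left)
  also have "\<dots> = (\<Sum>i\<in>R. \<Sum>j\<in>R. if j = i then (a i)\<^sup>2 * (\<Sum>e\<in>E. (u i e)\<^sup>2) else 0)"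
    by (intro sum.cong refl) (auto simp: orth power2_eq_square)
  also have "\<dots> = (\<Sum>i\<in>R. (a i)\<^sup>2 * (\<Sum>e\<in>E. (u i e)\<^sup>2))"
    using assms(1) by simp
  finally show ?thesis .
qed

text \<open>A matrix times its transpose and the transpose times the matrix have the same Frobenius norm.\<close>

lemma sum_Gram_squared:
  fixes u :: "'i \<Rightarrow> 'e \<Rightarrow> real"
  shows "(\<Sum>e\<in>S. \<Sum>e'\<in>S. (\<Sum>i\<in>R. u i e * u i e')\<^sup>2)
    = (\<Sum>i\<in>R. \<Sum>j\<in>R. (\<Sum>e\<in>S. u i e * u j e)\<^sup>2)"
proof -
  define t where "t e e' i j = (u i e * u j e) * (u i e' * u j e')" for e e' i j
  have "(\<Sum>e\<in>S. \<Sum>e'\<in>S. (\<Sum>i\<in>R. u i e * u i e')\<^sup>2) = (\<Sum>e\<in>S. \<Sum>e'\<in>S. \<Sum>i\<in>R. \<Sum>j\<in>R. t e e' i j)"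
    by (simp add: t_def power2_eq_square sum_product mult_ac)
  also have "\<dots> = (\<Sum>e\<in>S. \<Sum>i\<in>R. \<Sum>e'\<in>S. \<Sum>j\<in>R. t e e' i j)"
    by (rule sum.cong[OF refl], rule sum.swap)
  also have "\<dots> = (\<Sum>i\<in>R. \<Sum>e\<in>S. \<Sum>e'\<in>S. \<Sum>j\<in>R. t e e' i j)"
    by (rule sum.swap)
  also have "\<dots> = (\<Sum>i\<in>R. \<Sum>e\<in>S. \<Sum>j\<in>R. \<Sum>e'\<in>S. t e e' i j)"
    by (rule sum.cong[OF refl], rule sum.cong[OF refl], rule sum.swap)
  also have "\<dots> = (\<Sum>i\<in>R. \<Sum>j\<in>R. \<Sum>e\<in>S. \<Sum>e'\<in>S. t e e' i j)"
    by (rule sum.cong[OF refl], rule sum.swap)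
  also have "\<dots> = (\<Sum>i\<in>R. \<Sum>j\<in>R. (\<Sum>e\<in>S. u i e * u j e)\<^sup>2)"
    by (simp add: t_def power2_eq_square sum_product)
  finally show ?thesis .
qed

text \<open>Bessel's inequality for the coordinate function of \<open>e\<close>.\<close>

lemma Bessel_coordinate:
  fixes u :: "'i \<Rightarrow> 'e \<Rightarrow> real"
  assumes "finite R" "finite E"
    and orth: "\<And>i j. i \<in> R \<Longrightarrow> j \<in> R \<Longrightarrow> i \<noteq> j \<Longrightarrow> (\<Sum>e\<in>E. u i e * u j e) = 0"
    and norm: "\<And>i. i \<in> R \<Longrightarrow> (\<Sum>e\<in>E. (u i e)\<^sup>2) = N i"
    and pos: "\<And>i. i \<in> R \<Longrightarrow> N i > 0"
    and "e \<in> E"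
  shows "(\<Sum>i\<in>R. (u i e)\<^sup>2 / N i) \<le> 1"
proof -
  define t where "t = (\<Sum>i\<in>R. (u i e)\<^sup>2 / N i)"
  have "t\<^sup>2 = (\<Sum>i\<in>R. u i e / N i * u i e)\<^sup>2"
    by (simp add: t_def power2_eq_square)
  also have "\<dots> \<le> (\<Sum>e'\<in>E. (\<Sum>i\<in>R. u i e / N i * u i e')\<^sup>2)"
    using assms(2,6) by (intro member_le_sum) auto
  also have "\<dots> = (\<Sum>i\<in>R. (u i e / N i)\<^sup>2 * N i)"
    by (subst sum_square_orthogonal[OF assms(1) orth]) (simp_all add: norm)
  also have "\<dots> = t"
    unfolding t_def using pos
    by (intro sum.cong refl) (simp add: power2_eq_square less_imp_neq[THEN not_sym])
  finally have "t * t \<le> t" by (simp add: power2_eq_square)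
  then have "t * (t - 1) \<le> 0" by (simp add: algebra_simps)
  then show ?thesis unfolding t_def[symmetric] by (auto simp: mult_le_0_iff)
qed

lemma sum_indicator_mult:
  fixes E :: "'e set"
  assumes "finite E" "A \<subseteq> E"
  shows "(\<Sum>e\<in>E. indicat_real A e * indicat_real B e) = real (card (A \<inter> B))"
proof -
  have "(\<Sum>e\<in>E. indicat_real A e * indicat_real B e) = (\<Sum>e\<in>E. indicat_real (A \<inter> B) e)"
    by (simp add: indicator_inter_arith)
  also have "\<dots> = real (card (A \<inter> B))"
  proof -
    have "E \<inter> {e. e \<in> A \<inter> B} = A \<inter> B" using assms(2) by blast
    then show ?thesis using assms(1) by (simp only: indicator_def sum_of_bool_eq)
  qed
  finally show ?thesis .
qed

section \<open>Two degenerate pairs\<close>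

text \<open>
  In the application \<open>a\<close> and \<open>b\<close> are the sizes of two sets, \<open>x\<close> is the size of their intersection, and the last
  hypothesis says that the matrix with diagonal \<open>a - l\<close>, \<open>b - l\<close> and off-diagonal \<open>x - l\<close> is
  singular. Its kernel, normalised to coordinate sum 1, is \<open>(p, 1 - p)\<close>; the equation says that
  the corresponding convex combination of the two indicators has squared norm \<open>l\<close>.
\<close>

lemma degenerate_pair_centre:
  fixes a b x l :: real
  assumes "a > l" "b > l" "x < l" "(a - l) * (b - l) = (x - l)\<^sup>2"
  shows "\<exists>p. 0 < p \<and> p < 1 \<and> p\<^sup>2 * a + (1 - p)\<^sup>2 * b + 2 * p * (1 - p) * x = l
    \<and> (p = 1/2 \<longrightarrow> a = b)"
proof -
  define r s where "r = sqrt (b - l)" and "s = sqrt (a - l)"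
  have rs: "r > 0" "s > 0" "r\<^sup>2 = b - l" "s\<^sup>2 = a - l"
    using assms by (auto simp: r_def s_def)
  have "r * s = sqrt ((x - l)\<^sup>2)"
    unfolding r_def s_def assms(4)[symmetric] by (simp add: real_sqrt_mult)
  then have x: "x = l - r * s" using assms(3) by simp
  have ab: "a = l + s\<^sup>2" "b = l + r\<^sup>2" using rs by auto
  define p where "p = r / (r + s)"
  have q: "1 - p = s / (r + s)" using rs by (simp add: p_def field_simps)
  have "p\<^sup>2 * a + (1 - p)\<^sup>2 * b + 2 * p * (1 - p) * x
      = (r\<^sup>2 * a + s\<^sup>2 * b + 2 * r * s * x) / (r + s)\<^sup>2"
    unfolding q by (simp add: p_def power_divide power2_eq_square add_divide_distrib)
  also have "r\<^sup>2 * a + s\<^sup>2 * b + 2 * r * s * x = l * (r + s)\<^sup>2"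
    unfolding ab x by algebra
  finally have eq: "p\<^sup>2 * a + (1 - p)\<^sup>2 * b + 2 * p * (1 - p) * x = l"
    using rs by simp
  have half: "a = b" if "p = 1/2"
  proof -
    have "r = s" using that rs by (simp add: p_def field_simps)
    then show ?thesis using ab by simp
  qed
  show ?thesis
  proof (intro exI[of _ p] conjI impI)
    show "0 < p" "p < 1" using rs by (auto simp: p_def)
  qed (use eq half in auto)
qed

text \<open>
  The convex combinations attached to the two pairs have squared norm \<open>l\<close> and inner product \<open>l\<close>,
  so they coincide, by expanding the squared norm of their difference. The common function takes the value \<open>p\<close> on \<open>A - B\<close> and \<open>1 - p\<close> on \<open>B - A\<close>, and
  for \<open>p \<noteq> 1/2\<close> its values determine \<open>A\<close>, which would then be \<open>C\<close> or \<open>D\<close>.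
\<close>

lemma two_degenerate_pairs_equal_card:
  fixes A B C D :: "'e set" and l :: real
  assumes fin: "finite A" "finite B" "finite C" "finite D"
    and AB: "card A > l" "card B > l" "card (A \<inter> B) < l"
      "(card A - l) * (card B - l) = (card (A \<inter> B) - l)\<^sup>2"
    and CD: "card C > l" "card D > l" "card (C \<inter> D) < l"
      "(card C - l) * (card D - l) = (card (C \<inter> D) - l)\<^sup>2"
    and cross: "card (A \<inter> C) = l" "card (A \<inter> D) = l" "card (B \<inter> C) = l" "card (B \<inter> D) = l"
    and ne: "A \<noteq> C" "A \<noteq> D"
  shows "card A = card B"
proof -
  obtain p :: real where p: "0 < p" "p < 1"
    "p\<^sup>2 * card A + (1 - p)\<^sup>2 * card B + 2 * p * (1 - p) * card (A \<inter> B) = l"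
    "p = 1/2 \<Longrightarrow> real (card A) = card B"
    using degenerate_pair_centre[OF AB] by blast
  obtain q :: real where q: "0 < q" "q < 1"
    "q\<^sup>2 * card C + (1 - q)\<^sup>2 * card D + 2 * q * (1 - q) * card (C \<inter> D) = l"
    using degenerate_pair_centre[OF CD] by blast
  define E where "E = A \<union> B \<union> C \<union> D"
  \<comment> \<open>the difference of the two convex combinations\<close>
  define d where "d e = p * indicat_real A e + (1 - p) * indicat_real B e
      - (q * indicat_real C e + (1 - q) * indicat_real D e)" for e
  have E: "finite E" "A \<subseteq> E" "B \<subseteq> E" "C \<subseteq> E" "D \<subseteq> E" using fin by (auto simp: E_def)
  note ip = sum_indicator_mult[OF E(1)]
  let ?s = "\<lambda>X Y. \<Sum>e\<in>E. indicat_real X e * indicat_real Y e"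
  have "(\<Sum>e\<in>E. (d e)\<^sup>2) = (\<Sum>e\<in>E.
      p\<^sup>2 * (indicat_real A e * indicat_real A e)
      + (1 - p)\<^sup>2 * (indicat_real B e * indicat_real B e)
      + 2 * p * (1 - p) * (indicat_real A e * indicat_real B e)
      + (q\<^sup>2 * (indicat_real C e * indicat_real C e)
      + (1 - q)\<^sup>2 * (indicat_real D e * indicat_real D e)
      + 2 * q * (1 - q) * (indicat_real C e * indicat_real D e))
      - 2 * (p * q * (indicat_real A e * indicat_real C e)
      + p * (1 - q) * (indicat_real A e * indicat_real D e)
      + (1 - p) * q * (indicat_real B e * indicat_real C e)
      + (1 - p) * (1 - q) * (indicat_real B e * indicat_real D e)))"
    unfolding d_def by (intro sum.cong refl) (simp add: power2_eq_square algebra_simps)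
  also have "\<dots> = p\<^sup>2 * ?s A A + (1 - p)\<^sup>2 * ?s B B + 2 * p * (1 - p) * ?s A B
      + (q\<^sup>2 * ?s C C + (1 - q)\<^sup>2 * ?s D D + 2 * q * (1 - q) * ?s C D)
      - 2 * (p * q * ?s A C + p * (1 - q) * ?s A D
      + (1 - p) * q * ?s B C + (1 - p) * (1 - q) * ?s B D)"
    by (simp only: sum.distrib sum_subtractf flip: sum_distrib_left)
  also have "\<dots> = l + l - 2 * (p * q * l + p * (1 - q) * l + (1 - p) * q * l + (1 - p) * (1 - q) * l)"
    by (simp only: ip[OF E(2)] ip[OF E(3)] ip[OF E(4)] ip[OF E(5)] Int_absorb cross p(3) q(3))
  also have "\<dots> = 0" by (simp add: algebra_simps)
  finally have "\<forall>e\<in>E. (d e)\<^sup>2 = 0"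
    using E(1) by (subst (asm) sum_nonneg_eq_0_iff) auto
  then have d0: "d e = 0" for e
    by (cases "e \<in> E") (auto simp: d_def E_def)
  have "p = 1/2"
  proof (rule ccontr)
    assume np: "p \<noteq> 1/2"
    have "\<not> A \<subseteq> B"
    proof
      assume "A \<subseteq> B"
      then have "A \<inter> B = A" by blast
      then show False using AB by simp
    qed
    then obtain e where "e \<in> A" "e \<notin> B" by blast
    then have "p = q \<or> p = 1 - q"
      using d0[of e] p(1,2) by (cases "e \<in> C"; cases "e \<in> D"; simp add: d_def)
    then show False
    proof
      assume "p = q"
      then have "e \<in> A \<longleftrightarrow> e \<in> C" for e
        using d0[of e] p(1,2) np
        by (cases "e \<in> A"; cases "e \<in> B"; cases "e \<in> C"; cases "e \<in> D"; simp add: d_def)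
      then show False using ne by blast
    next
      assume "p = 1 - q"
      then have "q = 1 - p" by simp
      then have "e \<in> A \<longleftrightarrow> e \<in> D" for e
        using d0[of e] p(1,2) np
        by (cases "e \<in> A"; cases "e \<in> B"; cases "e \<in> C"; cases "e \<in> D"; simp add: d_def)
      then show False using ne by blast
    qed
  qed
  then show ?thesis using p(4) by simp
qed

section \<open>The structure of an almost Fisher family with many members\<close>

lemma almost_Fisher_unique_partner:
  assumes "almost_Fisher n 1 l \<F>" "A \<in> \<F>" "B \<in> \<F>" "C \<in> \<F>"
    and "A \<noteq> B" "card (A \<inter> B) \<noteq> l" "A \<noteq> C" "card (A \<inter> C) \<noteq> l"
  shows "B = C"
proof -
  have fin: "finite \<F>"
    using assms(1) by (auto simp: almost_Fisher_def intro: finite_subset)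
  have "card {F' \<in> \<F> - {A}. card (A \<inter> F') \<noteq> l} \<le> Suc 0"
    using assms(1,2) by (auto simp: almost_Fisher_def)
  then show ?thesis
    using assms fin by (subst (asm) card_le_Suc0_iff_eq) auto
qed

text \<open>
  Subtract \<open>l\<close> from all entries of the Gram matrix of the indicators of the members of \<open>\<F>\<close>. For a
  1-almost \<open>l\<close>-Fisher family the result is block diagonal, with blocks of order at most 2; the
  member \<open>F\<close> is degenerate if its block is singular. The first alternative is a block of order 1,
  the second a block of order 2.
\<close>

definition degenerate :: "nat \<Rightarrow> nat set set \<Rightarrow> nat set \<Rightarrow> bool" where
  "degenerate l \<F> F \<longleftrightarrow>
     card F = l \<and> (\<forall>G\<in>\<F> - {F}. card (F \<inter> G) = l) \<or>
     (\<exists>G\<in>\<F> - {F}. card (F \<inter> G) \<noteq> l \<and>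
        (real (card F) - l) * (real (card G) - l) = (real (card (F \<inter> G)) - l)\<^sup>2)"

text \<open>
  A family with at least \<open>n + 3\<close> members has a singular block other than that of the given member.
\<close>

lemma degenerate_member_exists:
  assumes af: "almost_Fisher n 1 l \<F>" and large: "card \<F> \<ge> n + 3" and "F\<^sub>1 \<in> \<F>"
  obtains F where "F \<in> \<F>" "degenerate l \<F> F" "F \<noteq> F\<^sub>1" "card (F \<inter> F\<^sub>1) = l"
proof -
  have sub: "\<And>F. F \<in> \<F> \<Longrightarrow> F \<subseteq> {1..n}" and fin: "finite \<F>"
    using af by (auto simp: almost_Fisher_def intro: finite_subset)
  \<comment> \<open>The coordinates in \<open>{1..n}\<close> are those of the indicator. Coordinate 0 makes the
    coefficients of a relation sum to zero, coordinate \<open>n + 1\<close> makes the one of \<open>F\<^sub>1\<close> vanish.\<close>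
  define w :: "nat set \<Rightarrow> nat \<Rightarrow> real" where "w F j = (if j = 0 then 1 else if j = Suc n then of_bool (F = F\<^sub>1)
      else indicat_real F j)" for F j
  obtain z where "\<exists>F\<in>\<F>. z F \<noteq> 0" and z: "\<forall>j\<in>{0..Suc n}. (\<Sum>F\<in>\<F>. z F * w F j) = 0"
    using nontrivial_relation_exists[of "{0..Suc n}" \<F> w] large fin by auto
  then obtain F where F: "F \<in> \<F>" "z F \<noteq> 0" by blast
  have z_sum: "(\<Sum>F\<in>\<F>. z F) = 0" using z[rule_format, of 0] by (simp add: w_def)
  have z_F1: "z F\<^sub>1 = 0"
  proof -
    have "z F\<^sub>1 = (\<Sum>F\<in>\<F>. if F = F\<^sub>1 then z F else 0)"
      using fin \<open>F\<^sub>1 \<in> \<F>\<close> by simp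
    also have "\<dots> = (\<Sum>F\<in>\<F>. z F * w F (Suc n))"
      by (intro sum.cong) (auto simp: w_def)
    finally show ?thesis using z[rule_format, of "Suc n"] by simp
  qed
  have z_elem: "(\<Sum>G\<in>\<F>. z G * indicat_real G j) = 0" if "j \<in> {1..n}" for j
    using z[rule_format, of j] that by (simp add: w_def)
  have ip: "(\<Sum>G\<in>\<F>. z G * (real (card (H \<inter> G)) - l)) = 0" if "H \<in> \<F>" for H
  proof -
    have "(\<Sum>G\<in>\<F>. z G * real (card (H \<inter> G)))
        = (\<Sum>G\<in>\<F>. z G * (\<Sum>j\<in>{1..n}. indicat_real H j * indicat_real G j))"
      by (simp only: sum_indicator_mult[OF finite_atLeastAtMost sub[OF that]])
    also have "\<dots> = (\<Sum>G\<in>\<F>. \<Sum>j\<in>{1..n}. z G * (indicat_real H j * indicat_real G j))"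
      by (simp only: sum_distrib_left)
    also have "\<dots> = (\<Sum>j\<in>{1..n}. indicat_real H j * (\<Sum>G\<in>\<F>. z G * indicat_real G j))"
      by (subst sum.swap) (simp add: sum_distrib_left algebra_simps)
    also have "\<dots> = 0" by (simp add: z_elem)
    finally show ?thesis
      by (simp add: right_diff_distrib sum_subtractf z_sum flip: sum_distrib_right)
  qed
  have pair: "z H * (real (card H) - l) + z G * (real (card (H \<inter> G)) - l) = 0"
    if "H \<in> \<F>" "G \<in> \<F>" "H \<noteq> G" "card (H \<inter> G) \<noteq> l" for H G
  proof -
    have "card (H \<inter> X) = l" if "X \<in> \<F> - {H, G}" for X
      using almost_Fisher_unique_partner[OF af, of H G X] that
        \<open>H \<in> \<F>\<close> \<open>G \<in> \<F>\<close> \<open>H \<noteq> G\<close> \<open>card (H \<inter> G) \<noteq> l\<close> by blast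
    then have "(\<Sum>X\<in>\<F>. z X * (real (card (H \<inter> X)) - l))
        = (\<Sum>X\<in>{H, G}. z X * (real (card (H \<inter> X)) - l))"
      using that(1,2) fin by (intro sum.mono_neutral_right) auto
    then show ?thesis using ip[OF that(1)] that(3) by simp
  qed
  have deg: "degenerate l \<F> F"
  proof (cases "\<exists>G\<in>\<F> - {F}. card (F \<inter> G) \<noteq> l")
    case True
    then obtain G where G: "G \<in> \<F>" "G \<noteq> F" "card (F \<inter> G) \<noteq> l" by auto
    have 1: "z F * (real (card F) - l) + z G * (real (card (F \<inter> G)) - l) = 0"
      using pair[of F G] F G by auto
    have 2: "z G * (real (card G) - l) + z F * (real (card (F \<inter> G)) - l) = 0"
      using pair[of G F] F G by (auto simp: Int_commute)
    have "z F * ((real (card F) - l) * (real (card G) - l) - (real (card (F \<inter> G)) - l)\<^sup>2) = 0"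
      using 1 2 by algebra
    then show ?thesis using F G by (auto simp: degenerate_def)
  next
    case False
    then have "(\<Sum>X\<in>\<F>. z X * (real (card (F \<inter> X)) - l)) = (\<Sum>X\<in>{F}. z X * (real (card (F \<inter> X)) - l))"
      using F fin by (intro sum.mono_neutral_right) auto
    then have "z F * (real (card F) - l) = 0" using ip[OF F(1)] by simp
    then show ?thesis using False F by (auto simp: degenerate_def)
  qed
  have ne: "F \<noteq> F\<^sub>1" using F z_F1 by auto
  have "card (F \<inter> F\<^sub>1) = l"
  proof (rule ccontr)
    assume "card (F \<inter> F\<^sub>1) \<noteq> l"
    then show False
      using pair[of F\<^sub>1 F] F \<open>F\<^sub>1 \<in> \<F>\<close> ne z_F1 by (auto simp: Int_commute)
  qed
  with that F deg ne show ?thesis by blast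
qed

text \<open>
  With at least three members, each member meets another one in exactly \<open>l\<close> points and so has
  size at least \<open>l\<close>. This fixes the signs of the entries of a singular block of order 2.
\<close>

lemma degenerate_cases:
  assumes af: "almost_Fisher n 1 l \<F>" and large: "card \<F> \<ge> 3"
    and F: "F \<in> \<F>" "degenerate l \<F> F"
  obtains (single) "card F = l" "\<forall>G\<in>\<F> - {F}. card (F \<inter> G) = l"
  | (pair) G where "G \<in> \<F>" "G \<noteq> F" "card (F \<inter> G) < l" "card F > l" "card G > l"
      "(real (card F) - l) * (real (card G) - l) = (real (card (F \<inter> G)) - l)\<^sup>2"
proof -
  have finm: "finite H" if "H \<in> \<F>" for H
    using af that by (auto simp: almost_Fisher_def intro: finite_subset)
  have fin: "finite \<F>"
    using af by (auto simp: almost_Fisher_def intro: finite_subset)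
  have ge: "card H \<ge> l" if H: "H \<in> \<F>" for H
  proof -
    have "\<exists>G\<in>\<F> - {H}. card (H \<inter> G) = l"
    proof (rule ccontr)
      assume "\<not> ?thesis"
      then have eq: "{F' \<in> \<F> - {H}. card (H \<inter> F') \<noteq> l} = \<F> - {H}" by blast
      have "card {F' \<in> \<F> - {H}. card (H \<inter> F') \<noteq> l} \<le> 1"
        using af H by (simp add: almost_Fisher_def)
      moreover have "card (\<F> - {H}) \<ge> 2" using large H fin by simp
      ultimately show False unfolding eq by linarith
    qed
    then obtain G where "card (H \<inter> G) = l" by blast
    then show ?thesis using card_mono[of H "H \<inter> G"] finm[OF H] by auto
  qed
  show ?thesis
  proof (cases "card F = l \<and> (\<forall>G\<in>\<F> - {F}. card (F \<inter> G) = l)")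
    case True
    then show ?thesis using single by blast
  next
    case False
    then obtain G where G: "G \<in> \<F>" "G \<noteq> F" "card (F \<inter> G) \<noteq> l"
      and det: "(real (card F) - l) * (real (card G) - l) = (real (card (F \<inter> G)) - l)\<^sup>2"
      using F(2) by (auto simp: degenerate_def)
    have gt: "card F > l" "card G > l"
      using det G ge[OF F(1)] ge[OF G(1)] by (auto simp: order_less_le)
    have "card (F \<inter> G) < l"
    proof (rule ccontr)
      assume "\<not> card (F \<inter> G) < l"
      define a b x where "a = real (card F) - l" and "b = real (card G) - l"
        and "x = real (card (F \<inter> G)) - l"
      have le: "card (F \<inter> G) \<le> card F" "card (F \<inter> G) \<le> card G"
        using finm F(1) G(1) by (auto intro!: card_mono)
      have x: "x > 0" "x \<le> a" "x \<le> b" "a * b = x\<^sup>2"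
        using \<open>\<not> card (F \<inter> G) < l\<close> G(3) le det by (auto simp: a_def b_def x_def)
      have "x * b \<le> x * x" using x mult_right_mono[of x a b] by (simp add: power2_eq_square)
      then have "b = x" using x by simp
      then have "a = x" using x by (simp add: power2_eq_square)
      have "F \<inter> G = F" "F \<inter> G = G"
        using \<open>a = x\<close> \<open>b = x\<close> finm F(1) G(1)
        by (intro card_subset_eq; auto simp: a_def b_def x_def)+
      then show False using G by blast
    qed
    then show ?thesis using pair G gt det by blast
  qed
qed

lemma balanced_pair_exists:
  assumes af: "almost_Fisher n 1 l \<F>" and large: "card \<F> \<ge> n + 3"
  obtains A B where "A \<in> \<F>" "B \<in> \<F>" "A \<noteq> B" "card A = card B" "card (A \<inter> B) < l"
    "card A + card (A \<inter> B) = 2 * l"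
proof -
  have finm: "finite H" if "H \<in> \<F>" for H
    using af that by (auto simp: almost_Fisher_def intro: finite_subset)
  have large3: "card \<F> \<ge> 3" using large by simp
  then obtain F\<^sub>0 where "F\<^sub>0 \<in> \<F>" by fastforce
  then obtain A where A: "A \<in> \<F>" "degenerate l \<F> A"
    using degenerate_member_exists[OF af large] by blast
  obtain C where C: "C \<in> \<F>" "degenerate l \<F> C" "C \<noteq> A" "card (C \<inter> A) = l"
    using degenerate_member_exists[OF af large A(1)] by blast
  \<comment> \<open>An unpaired member of size \<open>l\<close> is contained in all other members, so it leaves no room for
    a second singular block.\<close>
  have no_mixed: False
    if X: "X \<in> \<F>" "card X = l" "\<forall>G\<in>\<F> - {X}. card (X \<inter> G) = l"
      and Y: "Y \<in> \<F>" "degenerate l \<F> Y" "X \<noteq> Y" for X Y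
  proof -
    have sub: "X \<subseteq> G" if "G \<in> \<F>" "G \<noteq> X" for G
    proof -
      have "X \<inter> G = X" using X that finm by (intro card_subset_eq) auto
      then show ?thesis by blast
    qed
    show False using af large3 Y(1,2)
    proof (cases rule: degenerate_cases)
      case single
      then have "X = Y" using sub[OF Y(1)] Y X(2) finm by (intro card_subset_eq) auto
      then show False using Y by blast
    next
      case (pair G)
      have "G \<noteq> X" using pair X Y by auto
      then have "X \<subseteq> Y \<inter> G" using sub Y pair by blast
      then have "card X \<le> card (Y \<inter> G)" using finm Y by (intro card_mono) auto
      then show False using pair X by simp
    qed
  qed
  show ?thesis using af large3 A
  proof (cases rule: degenerate_cases)
    case single
    then show ?thesis using no_mixed[of A C] A C by blast
  next
    case AB: (pair B)
    show ?thesis using af large3 C(1,2)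
    proof (cases rule: degenerate_cases)
      case single
      then show ?thesis using no_mixed[of C A] A C by blast
    next
      case CD: (pair D)
      note uniq = almost_Fisher_unique_partner[OF af]
      have neq: "A \<noteq> D" "B \<noteq> C" using AB CD C(4) by (auto simp: Int_commute)
      have cross: "card (A \<inter> C) = l" "card (A \<inter> D) = l" "card (B \<inter> C) = l" "card (B \<inter> D) = l"
      proof -
        show "card (A \<inter> C) = l" using C by (simp add: Int_commute)
        show "card (A \<inter> D) = l"
          using uniq[of D A C] A AB C CD neq by (auto simp: Int_commute)
        show "card (B \<inter> C) = l"
          using uniq[of C B D] uniq[of B A C] A AB C CD neq by (auto simp: Int_commute)
        have "B \<noteq> D" using uniq[of B A C] A AB C CD neq by (auto simp: Int_commute)
        then show "card (B \<inter> D) = l"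
          using uniq[of B A D] A AB C CD neq by (auto simp: Int_commute)
      qed
      have eq: "card A = card B"
        by (rule two_degenerate_pairs_equal_card[of A B C D "real l"])
          (use A AB C CD neq cross finm in auto)
      have "(real (card A) - l)\<^sup>2 = (real (card (A \<inter> B)) - l)\<^sup>2"
        using AB(6) eq by (simp add: power2_eq_square)
      then have "real (card A) - l = l - real (card (A \<inter> B))"
        using AB by (simp add: power2_eq_iff)
      then have "card A + card (A \<inter> B) = 2 * l" by linarith
      then show ?thesis using that A AB eq by blast
    qed
  qed
qed

text \<open>
  A maximal conflict-free subfamily will do: every member outside it conflicts with a member
  inside, and each member inside serves at most one member outside.
\<close>

lemma Fisher_subfamily_exists:
  assumes af: "almost_Fisher n 1 l \<F>"
  obtains \<R> where "\<R> \<subseteq> \<F>" "card \<F> \<le> 2 * card \<R>"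
    "\<And>C D. C \<in> \<R> \<Longrightarrow> D \<in> \<R> \<Longrightarrow> C \<noteq> D \<Longrightarrow> card (C \<inter> D) = l"
proof -
  have fin: "finite \<F>"
    using af by (auto simp: almost_Fisher_def intro: finite_subset)
  define P where "P = {\<R>. \<R> \<subseteq> \<F> \<and> (\<forall>C\<in>\<R>. \<forall>D\<in>\<R>. C \<noteq> D \<longrightarrow> card (C \<inter> D) = l)}"
  have "finite P" using fin by (auto simp: P_def)
  moreover have "{} \<in> P" by (simp add: P_def)
  ultimately obtain \<R> where R: "\<R> \<in> P" and max: "\<And>\<Q>. \<Q> \<in> P \<Longrightarrow> \<R> \<subseteq> \<Q> \<Longrightarrow> \<Q> = \<R>"
    using finite_has_maximal[of P] by (metis empty_iff)
  have "\<exists>G\<in>\<R>. F \<noteq> G \<and> card (F \<inter> G) \<noteq> l" if "F \<in> \<F> - \<R>" for F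
  proof (rule ccontr)
    assume "\<not> ?thesis"
    then have "insert F \<R> \<in> P" using R that by (auto simp: P_def Int_commute)
    then show False using max that by blast
  qed
  then obtain f where f: "\<And>F. F \<in> \<F> - \<R> \<Longrightarrow> f F \<in> \<R> \<and> F \<noteq> f F \<and> card (F \<inter> f F) \<noteq> l"
    by metis
  have "inj_on f (\<F> - \<R>)"
  proof (rule inj_onI)
    fix F F' assume "F \<in> \<F> - \<R>" "F' \<in> \<F> - \<R>" "f F = f F'"
    then show "F = F'"
      using almost_Fisher_unique_partner[OF af, of "f F" F F'] f[of F] f[of F'] R
      by (auto simp: P_def Int_commute)
  qed
  moreover have "f ` (\<F> - \<R>) \<subseteq> \<R>" using f by blast
  moreover have finR: "finite \<R>" using R fin by (auto simp: P_def intro: finite_subset)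
  ultimately have "card (\<F> - \<R>) \<le> card \<R>" by (intro card_inj_on_le)
  then have "card \<F> \<le> 2 * card \<R>"
    using R fin finR by (auto simp: P_def card_Diff_subset)
  then show ?thesis using that[of \<R>] R by (auto simp: P_def)
qed

section \<open>The size of the family in the presence of a balanced pair\<close>

text \<open>
  The sets \<open>A\<close> and \<open>B\<close> need not belong to \<open>\<R>\<close>. The hypotheses on them say that the midpoint of their
  indicators has squared norm \<open>l\<close> and inner product \<open>l\<close> with all members of \<open>\<R>\<close>.
\<close>

lemma Fisher_family_balanced_pair_bounds:
  fixes \<R> :: "'e set set" and l :: nat
  assumes fin: "finite E" "finite \<R>" and sub: "\<And>C. C \<in> \<R> \<Longrightarrow> C \<subseteq> E"
    and Fisher: "\<And>C D. C \<in> \<R> \<Longrightarrow> D \<in> \<R> \<Longrightarrow> C \<noteq> D \<Longrightarrow> card (C \<inter> D) = l"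
    and AB: "A \<subseteq> E" "B \<subseteq> E" "card A = card B" "card A + card (A \<inter> B) = 2 * l"
    and h: "h = real l - card (A \<inter> B)" "h > 0"
    and centre: "\<And>C. C \<in> \<R> \<Longrightarrow> card (C \<inter> A) + card (C \<inter> B) = 2 * l"
  shows "real (card \<R>) \<le> 8 * h"
    and "real (card \<R>) - 4 * h \<le> sqrt (real (card E) * (card \<R> / h))"
proof -
  define S where "S = (A - B) \<union> (B - A)"
  define u :: "'e set \<Rightarrow> 'e \<Rightarrow> real"
    where "u C e = indicat_real C e - (indicat_real A e + indicat_real B e) / 2" for C e
  define X where "X = real (card \<R>)"
  have finAB: "finite A" "finite B" using AB fin(1) by (auto intro: finite_subset)
  have S: "S \<subseteq> E" "finite S" using AB fin(1) by (auto simp: S_def intro: finite_subset)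
  have card_S: "real (card S) = 4 * h"
  proof -
    have "card S = card (A - B) + card (B - A)"
      unfolding S_def using finAB by (intro card_Un_disjoint) auto
    moreover have "card (A - B) + card (A \<inter> B) = card A" "card (B - A) + card (A \<inter> B) = card B"
      using finAB card_Int_Diff[of A B] card_Int_Diff[of B A] by (auto simp: Int_commute)
    ultimately show ?thesis using AB h by linarith
  qed
  have u_S: "(u C e)\<^sup>2 = 1/4" if "e \<in> S" for C e
    using that by (auto simp: u_def S_def indicator_def power2_eq_square)
  have u_off: "(u C e)\<^sup>2 = \<bar>u C e\<bar>" "u C e * u D e \<ge> 0" if "e \<notin> S" for C D e
    using that by (auto simp: u_def S_def indicator_def power2_eq_square)

  have ip: "(\<Sum>e\<in>E. u C e * u D e) = real (card (C \<inter> D)) - l" if "C \<in> \<R>" "D \<in> \<R>" for C D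
  proof -
    note sm = sum_indicator_mult[OF fin(1)]
    let ?s = "\<lambda>X Y. \<Sum>e\<in>E. indicat_real X e * indicat_real Y e"
    have "(\<Sum>e\<in>E. u C e * u D e) = (\<Sum>e\<in>E. indicat_real C e * indicat_real D e
        - 1/2 * (indicat_real C e * indicat_real A e) - 1/2 * (indicat_real C e * indicat_real B e)
        - 1/2 * (indicat_real D e * indicat_real A e) - 1/2 * (indicat_real D e * indicat_real B e)
        + 1/4 * (indicat_real A e * indicat_real A e) + 1/4 * (indicat_real B e * indicat_real B e)
        + 1/2 * (indicat_real A e * indicat_real B e))"
      unfolding u_def by (intro sum.cong refl) (simp add: field_simps)
    also have "\<dots> = ?s C D - 1/2 * ?s C A - 1/2 * ?s C B - 1/2 * ?s D A - 1/2 * ?s D B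
        + 1/4 * ?s A A + 1/4 * ?s B B + 1/2 * ?s A B"
      by (simp only: sum.distrib sum_subtractf sum_distrib_left)
    also have "\<dots> = real (card (C \<inter> D)) - (real (card (C \<inter> A)) + real (card (C \<inter> B))) / 2
        - (real (card (D \<inter> A)) + real (card (D \<inter> B))) / 2
        + (real (card A) + real (card B) + 2 * real (card (A \<inter> B))) / 4"
      by (simp add: sm sub that AB(1,2)) (simp add: add_divide_distrib)
    also have "\<dots> = real (card (C \<inter> D)) - l"
      using centre[OF that(1), THEN arg_cong, of real] centre[OF that(2), THEN arg_cong, of real]
        AB(3) AB(4)[THEN arg_cong, of real] by simp
    finally show ?thesis .
  qed
  define N where "N C = (\<Sum>e\<in>E. (u C e)\<^sup>2)" for C
  have orth: "(\<Sum>e\<in>E. u C e * u D e) = 0" if "C \<in> \<R>" "D \<in> \<R>" "C \<noteq> D" for C D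
    using ip[OF that(1,2)] Fisher[OF that] by simp
  have sum_S: "(\<Sum>e\<in>S. (u C e)\<^sup>2) = h" for C
    using card_S by (simp add: u_S)
  have N_ge: "N C \<ge> h" for C
  proof -
    have "h = (\<Sum>e\<in>S. (u C e)\<^sup>2)" by (simp add: sum_S)
    also have "\<dots> \<le> N C" unfolding N_def using S fin by (intro sum_mono2) auto
    finally show ?thesis .
  qed
  have N_pos: "N C > 0" for C using N_ge[of C] h(2) by simp

  show "real (card \<R>) \<le> 8 * h"
  proof -
    \<comment> \<open>Both Gram matrices of the restrictions to \<open>S\<close> have the same sum of squared entries. The
      diagonal of the one indexed by \<open>S\<close> bounds it below; the signs of the entries \<open>p C D\<close> and
      \<open>\<bar>p C D\<bar> \<le> h\<close> bound it above.\<close>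
    define p where "p C D = (\<Sum>e\<in>S. u C e * u D e)" for C D
    have p_diag: "p C C = h" for C using sum_S[of C] by (simp add: p_def power2_eq_square)
    have p_off: "p C D \<le> 0" if "C \<in> \<R>" "D \<in> \<R>" "C \<noteq> D" for C D
    proof -
      have "p C D + (\<Sum>e\<in>E - S. u C e * u D e) = 0"
        using orth[OF that] sum.subset_diff[OF S(1) fin(1), of "\<lambda>e. u C e * u D e"]
        by (simp add: p_def)
      moreover have "(\<Sum>e\<in>E - S. u C e * u D e) \<ge> 0" by (intro sum_nonneg u_off) auto
      ultimately show ?thesis by linarith
    qed
    have p_abs: "\<bar>p C D\<bar> \<le> h" for C D
    proof -
      have "\<bar>p C D\<bar> \<le> (\<Sum>e\<in>S. \<bar>u C e * u D e\<bar>)" unfolding p_def by (rule sum_abs)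
      also have "\<dots> \<le> (\<Sum>e\<in>S. 1/4)"
      proof (rule sum_mono)
        fix e assume e: "e \<in> S"
        have u_half: "\<bar>u F e\<bar> = 1/2" for F
          using e by (auto simp: u_def S_def indicator_def)
        show "\<bar>u C e * u D e\<bar> \<le> 1/4" unfolding abs_mult u_half by simp
      qed
      also have "\<dots> = h" using card_S by simp
      finally show ?thesis .
    qed
    have "0 \<le> (\<Sum>e\<in>S. (\<Sum>C\<in>\<R>. u C e)\<^sup>2)" by (intro sum_nonneg) auto
    also have "\<dots> = (\<Sum>e\<in>S. \<Sum>C\<in>\<R>. \<Sum>D\<in>\<R>. u C e * u D e)"
      by (simp add: power2_eq_square sum_product)
    also have "\<dots> = (\<Sum>C\<in>\<R>. \<Sum>D\<in>\<R>. p C D)"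
      unfolding p_def by (subst sum.swap, intro sum.cong refl, subst sum.swap) simp
    finally have sum_p: "0 \<le> (\<Sum>C\<in>\<R>. \<Sum>D\<in>\<R>. p C D)" .
    have "h * X\<^sup>2 / 4 = (\<Sum>e\<in>S. (\<Sum>C\<in>\<R>. u C e * u C e)\<^sup>2)"
    proof -
      have diag: "(\<Sum>C\<in>\<R>. u C e * u C e) = X / 4" if "e \<in> S" for e
        unfolding u_S[OF that, unfolded power2_eq_square] by (simp add: X_def)
      have "(\<Sum>e\<in>S. (\<Sum>C\<in>\<R>. u C e * u C e)\<^sup>2) = (\<Sum>e\<in>S. (X / 4)\<^sup>2)"
        by (intro sum.cong refl) (simp only: diag)
      then show ?thesis using card_S by (simp add: power2_eq_square)
    qed
    also have "\<dots> \<le> (\<Sum>e\<in>S. \<Sum>e'\<in>S. (\<Sum>C\<in>\<R>. u C e * u C e')\<^sup>2)"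
      using S by (intro sum_mono member_le_sum) auto
    also have "\<dots> = (\<Sum>C\<in>\<R>. \<Sum>D\<in>\<R>. (p C D)\<^sup>2)"
      unfolding p_def by (rule sum_Gram_squared)
    also have "\<dots> \<le> (\<Sum>C\<in>\<R>. \<Sum>D\<in>\<R>. h * ((if D = C then 2 * h else 0) - p C D))"
    proof (intro sum_mono)
      fix C D assume CD: "C \<in> \<R>" "D \<in> \<R>"
      have "(p C D)\<^sup>2 = \<bar>p C D\<bar> * \<bar>p C D\<bar>" by (simp add: power2_eq_square)
      also have "\<dots> \<le> h * \<bar>p C D\<bar>" using p_abs by (intro mult_right_mono) auto
      also have "\<bar>p C D\<bar> = (if D = C then 2 * h else 0) - p C D"
        using p_off[OF CD] p_diag h(2) by auto
      finally show "(p C D)\<^sup>2 \<le> h * ((if D = C then 2 * h else 0) - p C D)" .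
    qed
    also have "\<dots> = h * (2 * h * X - (\<Sum>C\<in>\<R>. \<Sum>D\<in>\<R>. p C D))"
      using fin by (simp add: X_def sum_subtractf flip: sum_distrib_left)
    also have "\<dots> \<le> h * (2 * h * X)" using sum_p h(2) by simp
    finally have "(h * X) * X \<le> (h * X) * (8 * h)" by (simp add: power2_eq_square mult_ac)
    then have "X \<le> 8 * h"
      using h(2) by (cases "X = 0") (auto simp: X_def)
    then show ?thesis by (simp add: X_def)
  qed

  \<comment> \<open>The \<open>y e\<close> sum to \<open>card \<R>\<close> over all points, and each is at most 1 by Bessel's inequality; so
    the points off \<open>S\<close> must contribute at least \<open>card \<R> - 4 * h\<close>.\<close>
  define y where "y e = (\<Sum>C\<in>\<R>. (u C e)\<^sup>2 / N C)" for e
  have "X = (\<Sum>C\<in>\<R>. \<Sum>e\<in>E. (u C e)\<^sup>2 / N C)"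
  proof -
    have "(\<Sum>e\<in>E. (u C e)\<^sup>2 / N C) = 1" for C
      using N_pos[of C] by (simp add: N_def flip: sum_divide_distrib)
    then show ?thesis by (simp add: X_def)
  qed
  also have "\<dots> = (\<Sum>e\<in>E. y e)" unfolding y_def by (rule sum.swap)
  also have "\<dots> = (\<Sum>e\<in>E - S. y e) + (\<Sum>e\<in>S. y e)" by (rule sum.subset_diff[OF S(1) fin(1)])
  also have "(\<Sum>e\<in>S. y e) \<le> (\<Sum>e\<in>S. 1)"
  proof (rule sum_mono)
    fix e assume "e \<in> S"
    then show "y e \<le> 1"
      unfolding y_def using S(1) N_pos orth fin
      by (intro Bessel_coordinate[where E = E]) (auto simp: N_def)
  qed
  also have "\<dots> = 4 * h" using card_S by simp
  finally have X_le: "X - 4 * h \<le> (\<Sum>e\<in>E - S. y e)" by simp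
  have "(\<Sum>e\<in>E - S. y e)\<^sup>2 \<le> real (card (E - S)) * (\<Sum>e\<in>E - S. (y e)\<^sup>2)"
    using sum_squared_le_sum_of_squares[of y "E - S"] fin by (simp add: mult.commute)
  also have "\<dots> \<le> card E * (X / h)"
  proof (rule mult_mono)
    show "real (card (E - S)) \<le> card E" using fin by (simp add: card_mono)
    \<comment> \<open>Off \<open>S\<close> the squared entry is the entry itself up to a sign depending only on the point, so
      \<open>y\<close> is up to signs a linear combination of the orthogonal vectors.\<close>
    have "(\<Sum>e\<in>E - S. (y e)\<^sup>2) = (\<Sum>e\<in>E - S. (\<Sum>C\<in>\<R>. 1 / N C * u C e)\<^sup>2)"
    proof (rule sum.cong[OF refl])
      fix e assume e: "e \<in> E - S"
      have "(\<forall>C. u C e = \<bar>u C e\<bar>) \<or> (\<forall>C. u C e = - \<bar>u C e\<bar>)"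
        using e by (auto simp: u_def S_def indicator_def)
      then have "(\<Sum>C\<in>\<R>. 1 / N C * u C e) = y e \<or> (\<Sum>C\<in>\<R>. 1 / N C * u C e) = - y e"
      proof
        assume a: "\<forall>C. u C e = \<bar>u C e\<bar>"
        then have "(u C e)\<^sup>2 = u C e" for C using u_off(1)[of e C] e by simp
        then show ?thesis by (simp add: y_def)
      next
        assume a: "\<forall>C. u C e = - \<bar>u C e\<bar>"
        then have "(u C e)\<^sup>2 = - u C e" for C using u_off(1)[of e C] e by (metis DiffD2 minus_minus)
        then show ?thesis by (simp add: y_def sum_negf)
      qed
      then show "(y e)\<^sup>2 = (\<Sum>C\<in>\<R>. 1 / N C * u C e)\<^sup>2" by auto
    qed
    also have "\<dots> \<le> (\<Sum>e\<in>E. (\<Sum>C\<in>\<R>. 1 / N C * u C e)\<^sup>2)"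
      using fin by (intro sum_mono2) auto
    also have "\<dots> = (\<Sum>C\<in>\<R>. (1 / N C)\<^sup>2 * N C)"
      unfolding N_def using fin orth by (intro sum_square_orthogonal) auto
    also have "\<dots> \<le> (\<Sum>C\<in>\<R>. 1 / h)"
    proof (rule sum_mono)
      fix C
      have "(1 / N C)\<^sup>2 * N C = 1 / N C" using N_pos[of C] by (simp add: power2_eq_square)
      also have "\<dots> \<le> 1 / h" using N_ge[of C] h(2) by (simp add: frac_le)
      finally show "(1 / N C)\<^sup>2 * N C \<le> 1 / h" .
    qed
    also have "\<dots> = X / h" by (simp add: X_def)
    finally show "(\<Sum>e\<in>E - S. (y e)\<^sup>2) \<le> X / h" .
  qed (auto intro: sum_nonneg)
  finally have "(\<Sum>e\<in>E - S. y e) \<le> sqrt (card E * (X / h))" by (rule real_le_rsqrt)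
  with X_le show "real (card \<R>) - 4 * h \<le> sqrt (real (card E) * (card \<R> / h))"
    by (simp add: X_def)
qed

lemma almost_Fisher_card_le:
  assumes af: "almost_Fisher n 1 l \<F>" and large: "card \<F> \<ge> n + 3"
  shows "real (card \<F>) \<le> 8 * min (real l) ((real n - real l) / 3) + 24 * sqrt l"
proof -
  have sub: "\<And>F. F \<in> \<F> \<Longrightarrow> F \<subseteq> {1..n}" and fin: "finite \<F>"
    using af by (auto simp: almost_Fisher_def intro: finite_subset)
  obtain A B where A: "A \<in> \<F>" "B \<in> \<F>" "A \<noteq> B" "card A = card B" "card (A \<inter> B) < l"
    "card A + card (A \<inter> B) = 2 * l"
    using balanced_pair_exists[OF af large] by blast
  obtain \<R> where R: "\<R> \<subseteq> \<F>" "card \<F> \<le> 2 * card \<R>"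
    "\<And>C D. C \<in> \<R> \<Longrightarrow> D \<in> \<R> \<Longrightarrow> C \<noteq> D \<Longrightarrow> card (C \<inter> D) = l"
    using Fisher_subfamily_exists[OF af] by blast
  define h where "h = real l - card (A \<inter> B)"
  define X where "X = real (card \<R>)"
  have h: "h > 0" "h \<le> l" using A by (auto simp: h_def)
  have finAB: "finite A" "finite B" using sub A by (auto intro: finite_subset)
  have hn: "h \<le> (real n - real l) / 3"
  proof -
    have "card (A \<union> B) \<le> card {1..n}" using sub A by (intro card_mono) auto
    then have "card A + card B \<le> n + card (A \<inter> B)"
      using card_Un_Int[OF finAB] by simp
    then have "3 * l \<le> (n - l) + 3 * card (A \<inter> B)" "l \<le> n"
      using A(4,5,6) by linarith+
    then have "real (3 * l) \<le> real (n - l) + real (3 * card (A \<inter> B))" "l \<le> n"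
      by linarith+
    then show ?thesis unfolding h_def by (simp add: of_nat_diff)
  qed
  have centre: "card (C \<inter> A) + card (C \<inter> B) = 2 * l" if "C \<in> \<R>" for C
  proof -
    have C: "C \<in> \<F>" using that R by blast
    show ?thesis
    proof (cases "C = A \<or> C = B")
      case True
      then show ?thesis using A by (auto simp: Int_commute)
    next
      case False
      then have "card (A \<inter> C) = l" "card (B \<inter> C) = l"
        using almost_Fisher_unique_partner[OF af, of A B C]
          almost_Fisher_unique_partner[OF af, of B A C] A C by (auto simp: Int_commute)
      then show ?thesis by (simp add: Int_commute)
    qed
  qed
  have RE: "finite \<R>" "\<And>C. C \<in> \<R> \<Longrightarrow> C \<subseteq> {1..n}"
    using R(1) fin sub by (auto intro: finite_subset)
  note bounds = Fisher_family_balanced_pair_bounds[OF finite_atLeastAtMost RE R(3)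
      sub[OF A(1)] sub[OF A(2)] A(4,6) h_def h(1) centre]
  have X8: "X \<le> 8 * h"
    unfolding X_def by (rule bounds(1))
  have X4: "X - 4 * h \<le> sqrt (real n * (X / h))"
    using bounds(2) by (simp add: X_def)
  have "real n * (X / h) \<le> (16 * h) * 8"
    using X8 R(2) large h by (intro mult_mono) (auto simp: X_def field_simps)
  also have "\<dots> \<le> 12\<^sup>2 * l" using h by simp
  finally have "sqrt (real n * (X / h)) \<le> sqrt (12\<^sup>2 * l)" by (rule real_sqrt_le_mono)
  then have "X \<le> 4 * h + 12 * sqrt l" using X4 by (simp add: real_sqrt_mult)
  moreover have "real (card \<F>) \<le> 2 * X" using R(2) by (simp add: X_def)
  moreover have "h \<le> min (real l) ((real n - real l) / 3)" using h hn by simp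
  ultimately show ?thesis by linarith
qed

theorem theorem1p5:
  shows "\<exists>g :: nat \<Rightarrow> real. g \<in> o(\<lambda>l. real l) \<and>
    (\<forall>n l :: nat. n \<ge> 1 \<longrightarrow>
      real (max_almost_Fisher n 1 l) \<le>
        max (real n + 2) (8 * min (real l) ((real n - real l) / 3) + g l))"
proof (intro exI[of _ "\<lambda>l. 24 * sqrt (real l)"] conjI allI impI)
  show "(\<lambda>l. 24 * sqrt (real l)) \<in> o(\<lambda>l. real l)" by real_asymp
  fix n l :: nat
  have "max_almost_Fisher n 1 l \<in> {card \<F> |\<F>. almost_Fisher n 1 l \<F>}"
    unfolding max_almost_Fisher_def
    by (rule Max_in[OF finite_almost_Fisher_cards almost_Fisher_cards_nonempty])
  then obtain \<F> where F: "almost_Fisher n 1 l \<F>" "max_almost_Fisher n 1 l = card \<F>"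
    by blast
  show "real (max_almost_Fisher n 1 l) \<le>
      max (real n + 2) (8 * min (real l) ((real n - real l) / 3) + 24 * sqrt (real l))"
  proof (cases "card \<F> \<ge> n + 3")
    case True
    then show ?thesis using almost_Fisher_card_le[OF F(1)] F(2) by simp
  next
    case False
    then have "real (card \<F>) \<le> real n + 2" by linarith
    then show ?thesis using F(2) by simp
  qed
qed

end
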